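(* Let $(X,M_1,*_1)$ and $(Y,M_2,*_2)$ be uniformly locally finite fuzzy metric spaces (with $*_1,*_2$ having no zero divisors). If there is a coarse embedding $g:Y\to X$ and $(X,M_1,*_1)$ has property A, then $(Y,M_2,*_2)$ has property A. In particular, property A is inherited by fuzzy metric subspaces: if $(X,M_1,*_1)$ has property A and $Z\subseteq X$, then $(Z,M_1|_{Z\times Z\times(0,\infty)},*_1)$ has property A.
   Context: A continuous $t$-norm is a continuous, associative, commutative binary operation $*$ on $[0,1]$ with $a*1=a$ for all $a$, and $a*b\leq c*d$ whenever $a\leq c$ and $b\leq d$. Standing assumption: $t$-norms have no zero divisors, i.e. $a*b\neq 0$ whenever $a\neq 0$ and $b\neq 0$. A fuzzy metric space (George–Veeramani) is a triple $(X,M,* )$ with $X$ a set, $*$ a continuous $t$-norm, and $M:X\times X\times(0,\infty)\to[0,1]$ such that for all $x,y,z\in X$ and $s,t>0$: (1) $M(x,y,t)>0$; (2) $M(x,y,t)=1$ if and only if $x=y$; (3) $M(x,y,t)=M(y,x,t)$; (4) $M(x,y,t)*M(y,z,s)\leq M(x,z,t+s)$; (5) $M(x,y,\cdot)$ is continuous on $(0,\infty)$. For $x\in X$, $r\in(0,1)$, $t>0$, the ball is $B(x,r,t)=\{y\in X:M(x,y,t)>1-r\}$. The space is uniformly locally finite if for every $r\in(0,1)$ and $t>0$ there is $N_{r,t}>0$ with $|B(x,r,t)|<N_{r,t}$ for all $x\in X$. A uniformly locally finite fuzzy metric space $(X,M,* )$ has property A if for every $\varepsilon>0$, $t>0$,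 $r\in(0,1)$ there exist $t'>0$, $r'\in(0,1)$ and a family $\{A_x\}_{x\in X}$ of non-empty finite subsets of $X\times\mathbb{N}$ such that $A_x\subset B(x,r',t')\times\mathbb{N}$ for each $x$, and $|A_x\Delta A_y|<\varepsilon|A_x\cap A_y|$ whenever $M(x,y,t)>1-r$. Here $\Delta$ is symmetric difference. A map $g:Y\to X$ between fuzzy metric spaces $(Y,M_2,*_2)$, $(X,M_1,*_1)$ is: uniformly expansive if for all $A>0$ and $t>0$ there exist $B\in(0,1)$ and $t'>0$ such that $M_1(g(y),g(y'),t')\geq B$ whenever $M_2(y,y',t)\geq A$; effectively proper if for all $C>0$ and $t>0$ there exist $D\in(0,1)$ and $t'>0$ such that $M_2(y,y',t')\geq D$ whenever $M_1(g(y),g(y'),t)\geq C$; a coarse embedding if it is both uniformly expansive and effectively proper. *)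

theory Defs
  imports "HOL-Analysis.Analysis"
begin

(* Functions on [0,1]^2, X x X x (0,\<infinity>) and X are represented by total functions that are
   constrained, and consulted, only on these domains.  In particular the restriction of M to
   Z x Z x (0,\<infinity>) is represented by M itself, paired with the carrier Z. *)

locale continuous_tnorm =
  fixes T :: "real \<Rightarrow> real \<Rightarrow> real"
  assumes closed: "\<lbrakk>a \<in> {0..1}; b \<in> {0..1}\<rbrakk> \<Longrightarrow> T a b \<in> {0..1}"
    and continuous: "continuous_on ({0..1} \<times> {0..1}) (\<lambda>(a, b). T a b)"
    and assoc: "\<lbrakk>a \<in> {0..1}; b \<in> {0..1}; c \<in> {0..1}\<rbrakk> \<Longrightarrow> T (T a b) c = T a (T b c)"
    and commute: "\<lbrakk>a \<in> {0..1}; b \<in> {0..1}\<rbrakk> \<Longrightarrow> T a b = T b a"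
    and right_unit: "a \<in> {0..1} \<Longrightarrow> T a 1 = a"
    and mono: "\<lbrakk>a \<in> {0..1}; b \<in> {0..1}; c \<in> {0..1}; d \<in> {0..1}; a \<le> c; b \<le> d\<rbrakk>
      \<Longrightarrow> T a b \<le> T c d"

definition tnorm_no_zero_divisors :: "(real \<Rightarrow> real \<Rightarrow> real) \<Rightarrow> bool" where
  "tnorm_no_zero_divisors T \<longleftrightarrow>
     (\<forall>a\<in>{0..1}. \<forall>b\<in>{0..1}. a \<noteq> 0 \<longrightarrow> b \<noteq> 0 \<longrightarrow> T a b \<noteq> 0)"

locale fuzzy_metric_space = continuous_tnorm T
  for X :: "'a set" and M :: "'a \<Rightarrow> 'a \<Rightarrow> real \<Rightarrow> real" and T :: "real \<Rightarrow> real \<Rightarrow> real" +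
  assumes range: "\<lbrakk>x \<in> X; y \<in> X; t > 0\<rbrakk> \<Longrightarrow> M x y t \<in> {0..1}"
    and positive: "\<lbrakk>x \<in> X; y \<in> X; t > 0\<rbrakk> \<Longrightarrow> M x y t > 0"
    and eq_1_iff: "\<lbrakk>x \<in> X; y \<in> X; t > 0\<rbrakk> \<Longrightarrow> M x y t = 1 \<longleftrightarrow> x = y"
    and sym: "\<lbrakk>x \<in> X; y \<in> X; t > 0\<rbrakk> \<Longrightarrow> M x y t = M y x t"
    and triangle: "\<lbrakk>x \<in> X; y \<in> X; z \<in> X; t > 0; s > 0\<rbrakk>
      \<Longrightarrow> T (M x y t) (M y z s) \<le> M x z (t + s)"
    and continuous_M: "\<lbrakk>x \<in> X; y \<in> X\<rbrakk> \<Longrightarrow> continuous_on {0<..} (M x y)"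

definition fuzzy_ball ::
  "'a set \<Rightarrow> ('a \<Rightarrow> 'a \<Rightarrow> real \<Rightarrow> real) \<Rightarrow> 'a \<Rightarrow> real \<Rightarrow> real \<Rightarrow> 'a set" where
  "fuzzy_ball X M x r t = {y \<in> X. M x y t > 1 - r}"

locale ulf_fuzzy_metric_space = fuzzy_metric_space X M T
  for X :: "'a set" and M :: "'a \<Rightarrow> 'a \<Rightarrow> real \<Rightarrow> real" and T :: "real \<Rightarrow> real \<Rightarrow> real" +
  assumes uniformly_locally_finite: "\<lbrakk>0 < r; r < 1; t > 0\<rbrakk> \<Longrightarrow>
    \<exists>N::nat. N > 0 \<and> (\<forall>x\<in>X. finite (fuzzy_ball X M x r t) \<and> card (fuzzy_ball X M x r t) < N)"

(* To be applied to uniformly locally finite fuzzy metric spaces only. *)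
definition property_A :: "'a set \<Rightarrow> ('a \<Rightarrow> 'a \<Rightarrow> real \<Rightarrow> real) \<Rightarrow> bool" where
  "property_A X M \<longleftrightarrow>
     (\<forall>\<epsilon>>0. \<forall>t>0. \<forall>r. 0 < r \<and> r < 1 \<longrightarrow>
       (\<exists>t'>0. \<exists>r'. 0 < r' \<and> r' < 1 \<and>
         (\<exists>A :: 'a \<Rightarrow> ('a \<times> nat) set.
           (\<forall>x\<in>X. A x \<noteq> {} \<and> finite (A x) \<and> A x \<subseteq> fuzzy_ball X M x r' t' \<times> UNIV) \<and>
           (\<forall>x\<in>X. \<forall>y\<in>X. M x y t > 1 - r \<longrightarrow>
              real (card (sym_diff (A x) (A y))) < \<epsilon> * real (card (A x \<inter> A y))))))"

definition uniformly_expansive ::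
  "'b set \<Rightarrow> ('b \<Rightarrow> 'b \<Rightarrow> real \<Rightarrow> real) \<Rightarrow> ('a \<Rightarrow> 'a \<Rightarrow> real \<Rightarrow> real) \<Rightarrow> ('b \<Rightarrow> 'a) \<Rightarrow> bool" where
  "uniformly_expansive Y M2 M1 g \<longleftrightarrow>
     (\<forall>A>0. \<forall>t>0. \<exists>B. 0 < B \<and> B < 1 \<and> (\<exists>t'>0.
        \<forall>y\<in>Y. \<forall>y'\<in>Y. M2 y y' t \<ge> A \<longrightarrow> M1 (g y) (g y') t' \<ge> B))"

definition effectively_proper ::
  "'b set \<Rightarrow> ('b \<Rightarrow> 'b \<Rightarrow> real \<Rightarrow> real) \<Rightarrow> ('a \<Rightarrow> 'a \<Rightarrow> real \<Rightarrow> real) \<Rightarrow> ('b \<Rightarrow> 'a) \<Rightarrow> bool" where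
  "effectively_proper Y M2 M1 g \<longleftrightarrow>
     (\<forall>C>0. \<forall>t>0. \<exists>D. 0 < D \<and> D < 1 \<and> (\<exists>t'>0.
        \<forall>y\<in>Y. \<forall>y'\<in>Y. M1 (g y) (g y') t \<ge> C \<longrightarrow> M2 y y' t' \<ge> D))"

definition coarse_embedding ::
  "'b set \<Rightarrow> ('b \<Rightarrow> 'b \<Rightarrow> real \<Rightarrow> real) \<Rightarrow> 'a set \<Rightarrow> ('a \<Rightarrow> 'a \<Rightarrow> real \<Rightarrow> real) \<Rightarrow> ('b \<Rightarrow> 'a) \<Rightarrow> bool"
  where
  "coarse_embedding Y M2 X M1 g \<longleftrightarrow>
     g \<in> Y \<rightarrow> X \<and> uniformly_expansive Y M2 M1 g \<and> effectively_proper Y M2 M1 g"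

end

(* Move each set A_(g y) from X x N to Y x N by a single injective map phi.  Every x occurring in
   some A_(g y) lies near g(Y), so choose a p x in Y whose image is near x; effective properness
   keeps p x near y.  A fibre of p lies in one ball of X, hence is finite, so its points can be
   numbered, and the number can be stored in the second coordinate of phi(x, n).  As phi is
   injective, the cardinalities in property A do not change. *)

theory Submission
  imports Defs
begin

lemma (in fuzzy_metric_space) subspace:
  assumes "Z \<subseteq> X"
  shows "fuzzy_metric_space Z M T"
  by unfold_locales
    (rule range positive eq_1_iff sym triangle continuous_M; blast intro: subsetD[OF assms])+

lemma (in ulf_fuzzy_metric_space) ulf_subspace:
  assumes "Z \<subseteq> X"
  shows "ulf_fuzzy_metric_space Z M T"
proof -
  interpret Z: fuzzy_metric_space Z M T
    using assms by (rule subspace)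
  show ?thesis
  proof
    fix r t :: real
    assume "0 < r" "r < 1" "t > 0"
    then obtain N :: nat where N: "N > 0"
      "\<And>x. x \<in> X \<Longrightarrow> finite (fuzzy_ball X M x r t) \<and> card (fuzzy_ball X M x r t) < N"
      using uniformly_locally_finite by metis
    have "fuzzy_ball Z M x r t \<subseteq> fuzzy_ball X M x r t" for x
      using assms by (auto simp: fuzzy_ball_def)
    then have "finite (fuzzy_ball Z M x r t) \<and> card (fuzzy_ball Z M x r t) < N" if "x \<in> Z" for x
      using N(2)[of x] that assms by (meson card_mono finite_subset le_less_trans subsetD)
    with N(1) show "\<exists>N::nat. N > 0 \<and>
        (\<forall>x\<in>Z. finite (fuzzy_ball Z M x r t) \<and> card (fuzzy_ball Z M x r t) < N)"
      by blast
  qed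
qed

lemma coarse_embedding_inclusion:
  assumes "Z \<subseteq> X"
  shows "coarse_embedding Z M X M (\<lambda>z. z)"
proof -
  have "\<exists>B. 0 < B \<and> B < 1 \<and> (\<exists>t'>0. \<forall>y\<in>Z. \<forall>y'\<in>Z. M y y' t \<ge> A \<longrightarrow> M y y' t' \<ge> B)"
    if "A > 0" "t > 0" for A t :: real
    \<comment> \<open>The bound must lie below 1, while \<open>A\<close> may be any positive number.
      For the inclusion this one claim yields both halves of a coarse embedding.\<close>
    by (rule exI[of _ "min A (1/2)"]) (use that in auto)
  then show ?thesis
    using assms by (auto simp: coarse_embedding_def uniformly_expansive_def effectively_proper_def)
qed

text \<open>The triangle inequality through the common point \<open>z\<close> gives the bound
  \<open>T (1 - r) (1 - r)\<close>, which depends on no point. Its positivity is exactly what the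
  absence of zero divisors provides.\<close>

lemma (in fuzzy_metric_space) fuzzy_ball_common_point:
  assumes "tnorm_no_zero_divisors T" "0 < r" "r < 1" "t > 0"
  obtains C where "C > 0"
    "\<And>x y z. \<lbrakk>x \<in> X; y \<in> X; z \<in> fuzzy_ball X M x r t; z \<in> fuzzy_ball X M y r t\<rbrakk>
      \<Longrightarrow> M x y (t + t) \<ge> C"
proof
  have "T (1 - r) (1 - r) \<in> {0..1}" "T (1 - r) (1 - r) \<noteq> 0"
    using assms closed[of "1 - r" "1 - r"] by (auto simp: tnorm_no_zero_divisors_def)
  then show "T (1 - r) (1 - r) > 0"
    by auto
next
  fix x y z
  assume "x \<in> X" "y \<in> X" "z \<in> fuzzy_ball X M x r t" "z \<in> fuzzy_ball X M y r t"
  then have z: "z \<in> X" "M x z t > 1 - r" "M z y t > 1 - r"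
    using sym[of y z t] \<open>t > 0\<close> by (auto simp: fuzzy_ball_def)
  have "T (1 - r) (1 - r) \<le> T (M x z t) (M z y t)"
    using z \<open>x \<in> X\<close> \<open>y \<in> X\<close> assms(2-4) range[of x z t] range[of z y t]
    by (intro mono) simp_all
  also have "\<dots> \<le> M x y (t + t)"
    using z \<open>x \<in> X\<close> \<open>y \<in> X\<close> \<open>t > 0\<close> by (intro triangle)
  finally show "T (1 - r) (1 - r) \<le> M x y (t + t)" .
qed

text \<open>\<open>S\<close> may be too large to number as a whole, so \<open>c\<close> numbers each
  fibre of \<open>p\<close> separately. Two points with the same \<open>p\<close> value are numbered
  by the same enumeration, so the pair of \<open>p x\<close> and \<open>c x\<close> determines
  \<open>x\<close>; \<open>prod_encode\<close> leaves room for the old label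
  \<open>n\<close>.\<close>

lemma inj_on_finite_fibres_encode:
  assumes "\<And>y. finite {x \<in> S. p x = y}"
  obtains c :: "'a \<Rightarrow> nat"
  where "inj_on (\<lambda>(x, n). (p x, prod_encode (c x, n))) (S \<times> UNIV)"
proof
  define c where "c x = to_nat_on {x' \<in> S. p x' = p x} x" for x
  have "x = x'" if "x \<in> S" "x' \<in> S" "p x = p x'" "c x = c x'" for x x'
    using that assms[of "p x'"] unfolding c_def
    by (auto simp: countable_finite dest: inj_onD[OF inj_on_to_nat_on])
  then show "inj_on (\<lambda>(x, n). (p x, prod_encode (c x, n))) (S \<times> UNIV)"
    by (auto simp: inj_on_def)
qed

lemma property_A_coarse_embedding:
  assumes X: "ulf_fuzzy_metric_space X M1 T1" "tnorm_no_zero_divisors T1" "property_A X M1"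
    and g: "coarse_embedding Y M2 X M1 g"
  shows "property_A Y M2"
  unfolding property_A_def
proof (intro allI impI)
  interpret X: ulf_fuzzy_metric_space X M1 T1
    by (fact X(1))
  fix \<epsilon> t r :: real
  assume \<epsilon>: "\<epsilon> > 0" and t: "t > 0" and r: "0 < r \<and> r < 1"
  have gX: "g y \<in> X" if "y \<in> Y" for y
    using g that by (auto simp: coarse_embedding_def)
  obtain B s where B: "0 < B" "B < 1" and s: "s > 0"
    and expansive: "\<And>y y'. \<lbrakk>y \<in> Y; y' \<in> Y; M2 y y' t \<ge> 1 - r\<rbrakk> \<Longrightarrow> M1 (g y) (g y') s \<ge> B"
    using g t r unfolding coarse_embedding_def uniformly_expansive_def
    by (metis diff_gt_0_iff_gt)
  \<comment> \<open>Expansiveness yields only the weak bound \<open>B\<close>, whereas property A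
    asks for a strict one. With radius 1 - B/2 the threshold is B/2, strictly below
    \<open>B\<close>.\<close>
  have "0 < 1 - B/2 \<and> 1 - B/2 < 1"
    using B by auto
  from X(3)[unfolded property_A_def, rule_format, OF \<epsilon> s this]
  obtain s' q A where s': "s' > 0" and q: "0 < q" "q < 1"
    and A: "\<forall>x\<in>X. A x \<noteq> {} \<and> finite (A x) \<and> A x \<subseteq> fuzzy_ball X M1 x q s' \<times> (UNIV :: nat set)"
    and A_close: "\<forall>x\<in>X. \<forall>x'\<in>X. M1 x x' s > 1 - (1 - B/2)
      \<longrightarrow> real (card (sym_diff (A x) (A x'))) < \<epsilon> * real (card (A x \<inter> A x'))"
    by (elim exE conjE)
  \<comment> \<open>To be used for the centres \<open>g y\<close> and \<open>g (p x)\<close>, whose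
    balls both contain \<open>x\<close>; the time doubles because two steps of length
    \<open>s'\<close> are composed.\<close>
  obtain C where "C > 0" and C: "\<And>x y z. \<lbrakk>x \<in> X; y \<in> X; z \<in> fuzzy_ball X M1 x q s';
      z \<in> fuzzy_ball X M1 y q s'\<rbrakk> \<Longrightarrow> M1 x y (s' + s') \<ge> C"
    using X.fuzzy_ball_common_point[OF X(2) q s'] by metis
  moreover have "s' + s' > 0"
    using s' by simp
  ultimately obtain D u where D: "0 < D" "D < 1" and u: "u > 0"
    and proper: "\<And>y y'. \<lbrakk>y \<in> Y; y' \<in> Y; M1 (g y) (g y') (s' + s') \<ge> C\<rbrakk> \<Longrightarrow> M2 y y' u \<ge> D"
    using g unfolding coarse_embedding_def effectively_proper_def by metis
  define S where "S = (\<Union>y\<in>Y. fuzzy_ball X M1 (g y) q s')"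
  \<comment> \<open>The choice depends on \<open>x\<close> alone and not on the \<open>y\<close>
    whose set contains \<open>x\<close>, so that one map moves \<open>A (g y)\<close> and
    \<open>A (g y')\<close> alike.\<close>
  define p where "p x = (SOME y. y \<in> Y \<and> x \<in> fuzzy_ball X M1 (g y) q s')" for x
  have p: "p x \<in> Y \<and> x \<in> fuzzy_ball X M1 (g (p x)) q s'" if "x \<in> S" for x
    unfolding p_def by (rule someI_ex) (use that S_def in blast)
  \<comment> \<open>A fibre over a point \<open>y\<close> of \<open>Y\<close> lies in the ball
    around \<open>g y\<close>; any other fibre is empty.\<close>
  have "finite {x \<in> S. p x = y}" for y
  proof (cases "y \<in> Y")
    case True
    then have "finite (fuzzy_ball X M1 (g y) q s')"
      using X.uniformly_locally_finite[OF q s'] gX by blast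
    then show ?thesis
      by (rule rev_finite_subset) (use p in blast)
  next
    case False
    then have "{x \<in> S. p x = y} = {}"
      using p by blast
    then show ?thesis
      by (simp only: finite.emptyI)
  qed
  then obtain c :: "'a \<Rightarrow> nat"
    where inj: "inj_on (\<lambda>(x, n). (p x, prod_encode (c x, n))) (S \<times> UNIV)"
    using inj_on_finite_fibres_encode by blast
  define \<phi> where "\<phi> = (\<lambda>(x, n). (p x, prod_encode (c x, n)))"
  have A_S: "A (g y) \<subseteq> S \<times> UNIV" if "y \<in> Y" for y
    using bspec[OF A gX[OF that]] that unfolding S_def by blast
  have card_\<phi>: "card (\<phi> ` E) = card E" if "E \<subseteq> S \<times> UNIV" for E
    using inj_on_subset[OF inj that] unfolding \<phi>_def by (rule card_image)
  \<comment> \<open>Halving \<open>D\<close> again turns a weak bound into the strict one that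
    defines a ball.\<close>
  have "\<phi> ` A (g y) \<subseteq> fuzzy_ball Y M2 y (1 - D/2) u \<times> UNIV" if y: "y \<in> Y" for y
  proof
    fix v
    assume "v \<in> \<phi> ` A (g y)"
    then obtain x n where xn: "(x, n) \<in> A (g y)" "fst v = p x"
      by (auto simp: \<phi>_def)
    then have x: "x \<in> S" "x \<in> fuzzy_ball X M1 (g y) q s'"
      using bspec[OF A gX[OF y]] A_S[OF y] by auto
    then have "M1 (g y) (g (p x)) (s' + s') \<ge> C"
      using C p gX y by blast
    then have "M2 y (p x) u \<ge> D"
      using proper p x y by blast
    with D p[OF x(1)] xn(2) show "v \<in> fuzzy_ball Y M2 y (1 - D/2) u \<times> UNIV"
      by (auto simp: fuzzy_ball_def mem_Times_iff)
  qed
  moreover have "real (card (sym_diff (\<phi> ` A (g y)) (\<phi> ` A (g y'))))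
      < \<epsilon> * real (card (\<phi> ` A (g y) \<inter> \<phi> ` A (g y')))"
    if y: "y \<in> Y" "y' \<in> Y" and "M2 y y' t > 1 - r" for y y'
  proof -
    have sub: "A (g y) \<subseteq> S \<times> UNIV" "A (g y') \<subseteq> S \<times> UNIV"
      using A_S y by auto
    \<comment> \<open>Both sets lie in the domain on which \<phi> is injective, so taking images
      commutes with difference and intersection.\<close>
    have "sym_diff (\<phi> ` A (g y)) (\<phi> ` A (g y')) = \<phi> ` sym_diff (A (g y)) (A (g y'))"
      using inj sub unfolding \<phi>_def[symmetric]
      by (subst image_Un, intro arg_cong2[of _ _ _ _ "(\<union>)"] inj_on_image_set_diff[symmetric]) auto
    moreover have "\<phi> ` A (g y) \<inter> \<phi> ` A (g y') = \<phi> ` (A (g y) \<inter> A (g y'))"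
      using inj sub unfolding \<phi>_def[symmetric] by (intro inj_on_image_Int[symmetric])
    moreover have "sym_diff (A (g y)) (A (g y')) \<subseteq> S \<times> UNIV" "A (g y) \<inter> A (g y') \<subseteq> S \<times> UNIV"
      using sub by auto
    moreover have "M1 (g y) (g y') s > 1 - (1 - B/2)"
      using expansive[of y y'] that B by simp
    ultimately show ?thesis
      using A_close gX y by (simp add: card_\<phi>)
  qed
  moreover have "\<phi> ` A (g y) \<noteq> {} \<and> finite (\<phi> ` A (g y))" if "y \<in> Y" for y
    using bspec[OF A gX[OF that]] by simp
  moreover have "0 < 1 - D/2" "1 - D/2 < 1"
    using D by auto
  ultimately show "\<exists>t'>0. \<exists>r'. 0 < r' \<and> r' < 1 \<and> (\<exists>A' :: 'b \<Rightarrow> ('b \<times> nat) set.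
      (\<forall>y\<in>Y. A' y \<noteq> {} \<and> finite (A' y) \<and> A' y \<subseteq> fuzzy_ball Y M2 y r' t' \<times> UNIV) \<and>
      (\<forall>y\<in>Y. \<forall>y'\<in>Y. M2 y y' t > 1 - r \<longrightarrow>
        real (card (sym_diff (A' y) (A' y'))) < \<epsilon> * real (card (A' y \<inter> A' y'))))"
    by - (rule exI[of _ u], rule conjI[OF u], rule exI[of _ "1 - D/2"],
        intro conjI exI[of _ "\<lambda>y. \<phi> ` A (g y)"], simp_all)
qed

theorem mainTheorem3:
  fixes X :: "'a set" and M1 :: "'a \<Rightarrow> 'a \<Rightarrow> real \<Rightarrow> real" and T1 :: "real \<Rightarrow> real \<Rightarrow> real"
  assumes "ulf_fuzzy_metric_space X M1 T1"
    and "tnorm_no_zero_divisors T1"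
    and "property_A X M1"
  shows "(\<forall>(Y :: 'b set) M2 T2.
            ulf_fuzzy_metric_space Y M2 T2 \<longrightarrow> tnorm_no_zero_divisors T2 \<longrightarrow>
            (\<exists>g. coarse_embedding Y M2 X M1 g) \<longrightarrow> property_A Y M2) \<and>
         (\<forall>Z\<subseteq>X. ulf_fuzzy_metric_space Z M1 T1 \<and> property_A Z M1)"
proof (intro conjI allI impI)
  fix Y :: "'b set" and M2
  assume "\<exists>g. coarse_embedding Y M2 X M1 g"
  then show "property_A Y M2"
    using property_A_coarse_embedding[OF assms] by (elim exE)
next
  fix Z
  assume Z: "Z \<subseteq> X"
  show "ulf_fuzzy_metric_space Z M1 T1"
    by (rule ulf_fuzzy_metric_space.ulf_subspace[OF assms(1) Z])
  show "property_A Z M1"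
    \<comment> \<open>The first conjunct speaks of spaces over \<open>'b\<close>, while
      \<open>Z\<close> lives in \<open>'a\<close>; hence the appeal to the polymorphic
      lemma.\<close>
    by (rule property_A_coarse_embedding[OF assms coarse_embedding_inclusion[OF Z]])
qed

end
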